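(* Let $n\ge 3$, let $M\ge 1$ and $\bar M=\log M$, let $A\in{\cal P}_n\cap[1/M,M]^{n\times n}$, put $\bar a_{ij}=\log a_{ij}$, and let $K\ge 0$ be an integer. Consider the mixed 0-1 optimization problem in the real variables $\alpha$, $x_{ij}$ ($1\le i,j\le n$, $i\ne j$) and the binary variables $y_{ij}$ ($1\le i<j\le n$): $$\begin{array}{rll} \min & \alpha & \\ \mathrm{s.t.} & \sum_{i=1}^{n-2}\sum_{j=i+1}^{n-1}\sum_{k=j+1}^{n}\left(e^{x_{ik}-x_{ij}-x_{jk}}+e^{x_{ij}+x_{jk}-x_{ik}}\right)\le \alpha, & \\ & x_{ij}=-x_{ji}, & 1\le i<j\le n,\\ & -\bar M\le x_{ij}\le \bar M, & 1\le i<j\le n,\\ & -2\bar M y_{ij}\le x_{ij}-\bar a_{ij}\le 2\bar M y_{ij}, & 1\le i<j\le n,\\ & y_{ij}\in\{0,1\}, & 1\le i<j\le n,\\ & \sum_{i=1}^{n-1}\sum_{j=i+1}^{n} y_{ij}\le K. & \end{array}$$ Let $\alpha_{\mathrm{opt}}$ denote its optimum value. Then $\dfrac{\alpha_{\mathrm{opt}}}{\binom n3}-2$ is the minimal value of the inconsistency $CI_n$ that can be obtained by modifying at most $K$ elements above the main diagonal of $A$ (and their reciprocals), i.e. $$\frac{\alpha_{\mathrm{opt}}}{\binom n3}-2=\min\{\,CI_n(\hat A)\ :\ \hat A\in{\cal P}_n\cap[1/M,M]^{n\times n},\ d(A,\hat A)\le K\,\}.$$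
   Context: ${\cal P}_n$ is the set of $n\times n$ pairwise comparison matrices: real matrices $A=(a_{ij})$ with $a_{ij}>0$ and $a_{ij}=1/a_{ji}$ for all $i,j$ (so $a_{ii}=1$). $[1/M,M]^{n\times n}$ is the set of $n\times n$ matrices all of whose entries lie in $[1/M,M]$. For $A,\hat A\in{\cal P}_n$, $d(A,\hat A)=|\{(i,j):1\le i<j\le n,\ a_{ij}\ne\hat a_{ij}\}|$. The triads of $A\in{\cal P}_n$ are its $NT(n)=\binom n3$ principal $3\times3$ submatrices $\Gamma_1,\dots,\Gamma_{NT(n)}$ (one for each $1\le i<j<k\le n$, formed by rows and columns $i,j,k$). The inconsistency index of Pel\'aez and Lamata is $CI_n(A)=\det(A)$ for $n=3$ and $CI_n(A)=\frac{1}{NT(n)}\sum_{i=1}^{NT(n)}\det(\Gamma_i)$ for $n>3$. *)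

theory Defs
  imports Complex_Main
    "Jordan_Normal_Form.Determinant"
    "Jordan_Normal_Form.DL_Submatrix"
begin

(* Rows and columns are indexed by 0, ..., n - 1 throughout. *)

definition pairwise_comparison_matrices :: "nat \<Rightarrow> real mat set" where
  "pairwise_comparison_matrices n =
     {A \<in> carrier_mat n n. \<forall>i<n. \<forall>j<n. A $$ (i, j) > 0 \<and> A $$ (i, j) = 1 / A $$ (j, i)}"

definition box_matrices :: "nat \<Rightarrow> real \<Rightarrow> real mat set" where
  "box_matrices n M = {A \<in> carrier_mat n n. \<forall>i<n. \<forall>j<n. A $$ (i, j) \<in> {1 / M..M}}"

definition upper_diff :: "nat \<Rightarrow> real mat \<Rightarrow> real mat \<Rightarrow> nat" where
  "upper_diff n A B = card {(i, j). i < j \<and> j < n \<and> A $$ (i, j) \<noteq> B $$ (i, j)}"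

definition triad_indices :: "nat \<Rightarrow> (nat \<times> nat \<times> nat) set" where
  "triad_indices n = {(i, j, k). i < j \<and> j < k \<and> k < n}"

definition triad :: "real mat \<Rightarrow> nat \<times> nat \<times> nat \<Rightarrow> real mat" where
  "triad A = (\<lambda>(i, j, k). submatrix A {i, j, k} {i, j, k})"

(* The Pelaez-Lamata index; only meaningful for n at least 3. *)
definition CI :: "nat \<Rightarrow> real mat \<Rightarrow> real" where
  "CI n A =
     (if n = 3 then det A
      else 1 / real (n choose 3) * (\<Sum>t\<in>triad_indices n. det (triad A t)))"

(* The variables of the program are alpha, the x i j with i \<noteq> j and the y i j with
   i < j, all indices below n; values of the functions x and y at other arguments
   are neither constrained nor used, so they do not influence the optimum. *)
definition feasible ::
  "nat \<Rightarrow> real \<Rightarrow> real mat \<Rightarrow> nat \<Rightarrow> real \<Rightarrow> (nat \<Rightarrow> nat \<Rightarrow> real) \<Rightarrow> (nat \<Rightarrow> nat \<Rightarrow> real) \<Rightarrow> bool" where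
  "feasible n M A K \<alpha> x y \<longleftrightarrow>
     (\<Sum>i\<in>{0..<n-2}. \<Sum>j\<in>{i+1..<n-1}. \<Sum>k\<in>{j+1..<n}.
        exp (x i k - x i j - x j k) + exp (x i j + x j k - x i k)) \<le> \<alpha> \<and>
     (\<forall>i j. i < j \<and> j < n \<longrightarrow>
        x i j = - x j i \<and>
        - ln M \<le> x i j \<and> x i j \<le> ln M \<and>
        - 2 * ln M * y i j \<le> x i j - ln (A $$ (i, j)) \<and>
        x i j - ln (A $$ (i, j)) \<le> 2 * ln M * y i j \<and>
        y i j \<in> {0, 1}) \<and>
     (\<Sum>i\<in>{0..<n-1}. \<Sum>j\<in>{i+1..<n}. y i j) \<le> real K"

definition is_min_value :: "('a \<Rightarrow> real) \<Rightarrow> ('a \<Rightarrow> bool) \<Rightarrow> real \<Rightarrow> bool" where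
  "is_min_value f P v \<longleftrightarrow> (\<exists>z. is_arg_min f P z \<and> f z = v)"

end

theory Submission
  imports Defs "HOL-Analysis.Function_Topology"
begin

text \<open>
  In logarithmic coordinates a pairwise comparison matrix is a real function on the pairs
  \<open>(i, j)\<close> with \<open>i < j\<close>, and the determinant of a triad with upper entries \<open>a\<close>, \<open>b\<close>, \<open>c\<close> (where
  \<open>b\<close> is the entry in the corner) is \<open>b / (a c) + a c / b - 2\<close>, that is, one summand of the
  constraint of the program, minus two. As there are \<open>n choose 3\<close> triads, the index is the affine
  function \<open>s / (n choose 3) - 2\<close> of the exponential sum \<open>s\<close>.

  Both optimization problems therefore minimize the same sum over the same set, the set of
  \<^emph>\<open>admissible\<close> logarithms: those in the box that differ from the logarithms of the given matrix in
  at most \<open>K\<close> places. The big-M constraint says that \<open>x i j\<close> agrees with the old logarithm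
  unless \<open>y i j = 1\<close>; it restricts nothing when \<open>y i j = 1\<close>, since two points of the box are at most
  \<open>2 * ln M\<close> apart. So in the program \<open>y\<close> merely counts modifications, and \<open>\<alpha>\<close> bounds the sum.

  It remains to see that the minimum is attained (lemma \<open>compact_sparse_modifications\<close>): once the set
  of modified places is chosen, the admissible logarithms form a product of
  compact intervals and points, and there are only finitely many choices of that set.
\<close>

section \<open>Transferring attained minima\<close>

text \<open>The value of one problem passes to another as soon as each feasible point of either
  is matched by a feasible point of the other that is at least as good. The points need not
  correspond bijectively: the slack in \<open>\<alpha>\<close> and a superfluous \<open>y i j = 1\<close> destroy that.\<close>

lemma is_min_value_transfer:
  assumes "is_min_value g Q v"
    and "\<And>z. P z \<Longrightarrow> \<exists>w. Q w \<and> g w \<le> f z"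
    and "\<And>w. Q w \<Longrightarrow> \<exists>z. P z \<and> f z \<le> g w"
  shows "is_min_value f P v"
proof -
  from assms(1) obtain w where w: "Q w" "g w = v" and min: "\<And>w'. Q w' \<Longrightarrow> v \<le> g w'"
    by (auto simp: is_min_value_def is_arg_min_def not_less)
  from assms(3)[OF w(1)] w(2) obtain z where z: "P z" "f z \<le> v"
    by blast
  have low: "v \<le> f z'" if "P z'" for z'
    using assms(2)[OF that] min by force
  have "f z = v"
    using z(2) low[OF z(1)] by simp
  with z(1) low show ?thesis
    by (auto simp: is_min_value_def is_arg_min_def not_less)
qed

lemma is_min_value_mono:
  assumes "is_min_value g Q v" and "mono h"
  shows "is_min_value (\<lambda>w. h (g w)) Q (h v)"
proof -
  from assms(1) obtain w where w: "Q w" "g w = v" and min: "\<And>w'. Q w' \<Longrightarrow> v \<le> g w'"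
    by (auto simp: is_min_value_def is_arg_min_def not_less)
  have "h v \<le> h (g w')" if "Q w'" for w'
    by (rule monoD[OF \<open>mono h\<close> min[OF that]])
  with w show ?thesis
    by (auto simp: is_min_value_def is_arg_min_def not_less)
qed

lemma compact_imp_is_min_value:
  assumes "compact C" and "C \<noteq> {}" and "continuous_on C g"
  shows "\<exists>v. is_min_value g (\<lambda>w. w \<in> C) v"
proof -
  from continuous_attains_inf[OF assms] obtain w where "w \<in> C" "\<forall>w'\<in>C. g w \<le> g w'"
    by blast
  then show ?thesis
    unfolding is_min_value_def is_arg_min_def by (meson not_less)
qed

section \<open>Compactness of sparse modifications\<close>

lemma compact_pointwise:
  fixes T :: "'i \<Rightarrow> 'a::topological_space set"
  assumes "\<And>p. compact (T p)"
  shows "compact {u. \<forall>p. u p \<in> T p}"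
proof -
  have "compactin (product_topology (\<lambda>_. euclidean) UNIV) (PiE UNIV T)"
    using assms by (simp add: compactin_PiE)
  moreover have "PiE UNIV T = {u. \<forall>p. u p \<in> T p}"
    by (auto simp: PiE_def)
  ultimately show ?thesis
    by (simp add: euclidean_product_topology)
qed

definition sparse_modifications ::
  "'i set \<Rightarrow> 'a set \<Rightarrow> ('i \<Rightarrow> 'a) \<Rightarrow> nat \<Rightarrow> ('i \<Rightarrow> 'a) set" where
  "sparse_modifications I T a K =
     {u. (\<forall>p\<in>I. u p \<in> T) \<and> (\<forall>p. p \<notin> I \<longrightarrow> u p = a p) \<and> card {p \<in> I. u p \<noteq> a p} \<le> K}"

text \<open>Deciding in advance which places may change turns the counting condition into a product
  of sets; the whole set is the union over all sets \<open>D\<close> of at most \<open>K\<close> places.\<close>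

lemma compact_sparse_modifications:
  fixes T :: "'a::topological_space set"
  assumes "finite I" and "compact T" and a: "\<And>p. p \<in> I \<Longrightarrow> a p \<in> T"
  shows "compact (sparse_modifications I T a K)"
proof -
  let ?box = "\<lambda>D. {u. \<forall>p. u p \<in> (if p \<in> D then T else {a p})}"
  have "sparse_modifications I T a K = (\<Union>D\<in>{D. D \<subseteq> I \<and> card D \<le> K}. ?box D)"
  proof (intro equalityI subsetI)
    fix u assume "u \<in> sparse_modifications I T a K"
    then have "{p \<in> I. u p \<noteq> a p} \<in> {D. D \<subseteq> I \<and> card D \<le> K}" "u \<in> ?box {p \<in> I. u p \<noteq> a p}"
      by (auto simp: sparse_modifications_def)
    then show "u \<in> (\<Union>D\<in>{D. D \<subseteq> I \<and> card D \<le> K}. ?box D)"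
      by blast
  next
    fix u assume "u \<in> (\<Union>D\<in>{D. D \<subseteq> I \<and> card D \<le> K}. ?box D)"
    then obtain D where D: "D \<subseteq> I" "card D \<le> K" and u: "\<And>p. u p \<in> (if p \<in> D then T else {a p})"
      by auto
    have out: "u p = a p" if "p \<notin> D" for p
      using u[of p] that by simp
    then have "{p \<in> I. u p \<noteq> a p} \<subseteq> D"
      by auto
    then have "card {p \<in> I. u p \<noteq> a p} \<le> K"
      using D finite_subset[OF D(1) \<open>finite I\<close>] card_mono le_trans by metis
    moreover have "u p \<in> T" if "p \<in> I" for p
      using u[of p] a[OF that] by (cases "p \<in> D") auto
    ultimately show "u \<in> sparse_modifications I T a K"
      using out D(1) by (auto simp: sparse_modifications_def)
  qed
  moreover have "compact (?box D)" for D
    by (rule compact_pointwise) (use \<open>compact T\<close> in auto)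
  moreover have "finite {D. D \<subseteq> I \<and> card D \<le> K}"
    using \<open>finite I\<close> by (rule rev_finite_subset[OF finite_Pow_iff[THEN iffD2]]) auto
  ultimately show ?thesis
    by (simp add: compact_UN)
qed

section \<open>Triads\<close>

definition upper_pairs :: "nat \<Rightarrow> (nat \<times> nat) set" where
  "upper_pairs n = {(i, j). i < j \<and> j < n}"

lemma finite_upper_pairs: "finite (upper_pairs n)"
  by (rule finite_subset[of _ "{..<n} \<times> {..<n}"]) (auto simp: upper_pairs_def)

lemma sum_upper_pairs:
  "(\<Sum>i\<in>{0..<n-1}. \<Sum>j\<in>{i+1..<n}. f i j) = (\<Sum>(i, j)\<in>upper_pairs n. f i j)"
proof -
  have "upper_pairs n = Sigma {0..<n-1} (\<lambda>i. {i+1..<n})"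
    by (auto simp: upper_pairs_def)
  then show ?thesis
    by (simp add: sum.Sigma)
qed

lemma finite_triad_indices: "finite (triad_indices n)"
  by (rule finite_subset[of _ "{..<n} \<times> {..<n} \<times> {..<n}"]) (auto simp: triad_indices_def)

lemma sum_triad_indices:
  "(\<Sum>i\<in>{0..<n-2}. \<Sum>j\<in>{i+1..<n-1}. \<Sum>k\<in>{j+1..<n}. f i j k) =
     (\<Sum>(i, j, k)\<in>triad_indices n. f i j k)"
proof -
  have "triad_indices n = Sigma {0..<n-2} (\<lambda>i. Sigma {i+1..<n-1} (\<lambda>j. {j+1..<n}))"
    by (auto simp: triad_indices_def)
  then show ?thesis
    by (simp add: sum.Sigma)
qed

text \<open>A triad is a three-element set of indices, listed in increasing order.\<close>

lemma card_triad_indices: "card (triad_indices n) = n choose 3"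
proof -
  have "bij_betw (\<lambda>(i, j, k). {i, j, k}) (triad_indices n) {X. X \<subseteq> {..<n} \<and> card X = 3}"
  proof (rule bij_betw_imageI)
    show "inj_on (\<lambda>(i, j, k). {i, j, k}) (triad_indices n)"
    proof (rule inj_onI)
      fix s t
      assume s: "s \<in> triad_indices n" and t: "t \<in> triad_indices n"
        and eq: "(\<lambda>(i, j, k). {i, j, k}) s = (\<lambda>(i, j, k). {i, j, k}) t"
      obtain i j k i' j' k' where [simp]: "s = (i, j, k)" "t = (i', j', k')"
        by (cases s, cases t)
      have "[i, j, k] = [i', j', k']"
        using s t eq by (intro strict_sorted_equal) (simp_all add: triad_indices_def)
      then show "s = t"
        by simp
    qed
    show "(\<lambda>(i, j, k). {i, j, k}) ` triad_indices n = {X. X \<subseteq> {..<n} \<and> card X = 3}"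
    proof (intro equalityI subsetI)
      fix X assume "X \<in> (\<lambda>(i, j, k). {i, j, k}) ` triad_indices n"
      then show "X \<in> {X. X \<subseteq> {..<n} \<and> card X = 3}"
        by (auto simp: triad_indices_def)
    next
      fix X assume "X \<in> {X. X \<subseteq> {..<n} \<and> card X = 3}"
      then have X: "X \<subseteq> {..<n}" "finite X" and "length (sorted_list_of_set X) = Suc (Suc (Suc 0))"
        by (auto intro: finite_subset)
      then obtain i j k where l: "sorted_list_of_set X = [i, j, k]"
        by (metis length_Suc_conv length_0_conv)
      have "X = {i, j, k}"
        using l X(2) set_sorted_list_of_set[of X] by simp
      moreover have "i < j" "j < k"
        using l strict_sorted_list_of_set[of X] by simp_all
      ultimately show "X \<in> (\<lambda>(i, j, k). {i, j, k}) ` triad_indices n"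
        using X(1) by (auto simp: triad_indices_def image_iff intro!: bexI[of _ "(i, j, k)"])
    qed
  qed
  then show ?thesis
    by (simp add: bij_betw_same_card n_subsets)
qed

lemma det_2:
  assumes "(G :: 'a::comm_ring_1 mat) \<in> carrier_mat 2 2"
  shows "det G = G $$ (0, 0) * G $$ (1, 1) - G $$ (0, 1) * G $$ (1, 0)"
proof -
  have "det (mat_delete G 0 j) = mat_delete G 0 j $$ (0, 0)" for j
    by (rule det_single) (use assms in \<open>auto simp: mat_delete_def\<close>)
  then show ?thesis
    using assms laplace_expansion_row[OF assms, of 0]
    by (simp add: numeral_2_eq_2 cofactor_def mat_delete_def)
qed

lemma det_3:
  assumes "(G :: 'a::comm_ring_1 mat) \<in> carrier_mat 3 3"
  shows "det G =
      G $$ (0, 0) * (G $$ (1, 1) * G $$ (2, 2) - G $$ (1, 2) * G $$ (2, 1))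
    - G $$ (0, 1) * (G $$ (1, 0) * G $$ (2, 2) - G $$ (1, 2) * G $$ (2, 0))
    + G $$ (0, 2) * (G $$ (1, 0) * G $$ (2, 1) - G $$ (1, 1) * G $$ (2, 0))"
proof -
  have minor: "det (mat_delete G 0 j) =
      G $$ (1, if 0 < j then 0 else 1) * G $$ (2, if 1 < j then 1 else 2)
    - G $$ (1, if 1 < j then 1 else 2) * G $$ (2, if 0 < j then 0 else 1)" for j
  proof -
    have "mat_delete G 0 j \<in> carrier_mat 2 2"
      using assms by (auto simp: mat_delete_def)
    then show ?thesis
      using assms by (subst det_2) (auto simp: mat_delete_def numeral_2_eq_2)
  qed
  show ?thesis
    using laplace_expansion_row[OF assms, of 0]
    by (simp add: minor numeral_3_eq_3 numeral_2_eq_2 cofactor_def algebra_simps)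
qed

definition triad_cost :: "(nat \<times> nat \<Rightarrow> real) \<Rightarrow> nat \<times> nat \<times> nat \<Rightarrow> real" where
  "triad_cost u = (\<lambda>(i, j, k).
     exp (u (i, k) - u (i, j) - u (j, k)) + exp (u (i, j) + u (j, k) - u (i, k)))"

text \<open>The reciprocity equation is an instance of its own right-hand side, so it rewrites forever;
  the following rules are meant for single steps, in place of unfolding the definition under the
  simplifier.\<close>

lemma pairwise_comparison_carrier:
  "A \<in> pairwise_comparison_matrices n \<Longrightarrow> A \<in> carrier_mat n n"
  unfolding pairwise_comparison_matrices_def by blast

lemma pairwise_comparison_pos:
  "A \<in> pairwise_comparison_matrices n \<Longrightarrow> i < n \<Longrightarrow> j < n \<Longrightarrow> A $$ (i, j) > 0"
  unfolding pairwise_comparison_matrices_def by blast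

lemma pairwise_comparison_reciprocal:
  "A \<in> pairwise_comparison_matrices n \<Longrightarrow> i < n \<Longrightarrow> j < n \<Longrightarrow> A $$ (i, j) = 1 / A $$ (j, i)"
  unfolding pairwise_comparison_matrices_def by blast

lemma pairwise_comparison_diag:
  assumes "A \<in> pairwise_comparison_matrices n" and "i < n"
  shows "A $$ (i, i) = 1"
proof -
  have pos: "A $$ (i, i) > 0"
    using pairwise_comparison_pos[OF assms(1,2,2)] .
  have "A $$ (i, i) * A $$ (i, i) = A $$ (i, i) * (1 / A $$ (i, i))"
    using pairwise_comparison_reciprocal[OF assms(1,2,2)] by (rule arg_cong)
  also have "\<dots> = 1"
    using pos by simp
  finally have "A $$ (i, i) = 1 \<or> A $$ (i, i) = - 1"
    by (simp only: square_eq_1_iff)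
  with pos show ?thesis
    by auto
qed

text \<open>Of the six products in the determinant, four equal 1 up to sign and sum to -2; the two
  remaining ones belong to the two cyclic permutations and are reciprocal to each other.\<close>

lemma det_pairwise_comparison_3:
  assumes G: "G \<in> pairwise_comparison_matrices 3"
  shows "det G = triad_cost (\<lambda>p. ln (G $$ p)) (0, 1, 2) - 2"
proof -
  have pos: "G $$ (0, 1) > 0" "G $$ (1, 2) > 0" "G $$ (0, 2) > 0"
    by (intro pairwise_comparison_pos[OF G]; simp)+
  have rec: "G $$ (1, 0) = 1 / G $$ (0, 1)" "G $$ (2, 1) = 1 / G $$ (1, 2)"
      "G $$ (2, 0) = 1 / G $$ (0, 2)"
    by (intro pairwise_comparison_reciprocal[OF G]; simp)+
  have diag: "G $$ (0, 0) = 1" "G $$ (1, 1) = 1" "G $$ (2, 2) = 1"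
    by (intro pairwise_comparison_diag[OF G]; simp)+
  show ?thesis
    unfolding det_3[OF pairwise_comparison_carrier[OF G]] diag rec
    using pos by (simp add: triad_cost_def exp_add exp_diff field_simps)
qed

lemma triad_pairwise_comparison:
  assumes A: "A \<in> pairwise_comparison_matrices n" and ijk: "(i, j, k) \<in> triad_indices n"
  shows "triad A (i, j, k) \<in> pairwise_comparison_matrices 3"
    and "triad A (i, j, k) $$ (0, 1) = A $$ (i, j)"
    and "triad A (i, j, k) $$ (0, 2) = A $$ (i, k)"
    and "triad A (i, j, k) $$ (1, 2) = A $$ (j, k)"
proof -
  have ord: "i < j" "j < k" "k < n" and dim: "dim_row A = n" "dim_col A = n"
    using ijk pairwise_comparison_carrier[OF A] by (auto simp: triad_indices_def)
  let ?I = "{i, j, k}"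
  \<comment> \<open>\<open>e\<close> lists the three indices in increasing order, which is how submatrices number their rows.\<close>
  define e where "e = (\<lambda>r::nat. if r = 0 then i else if r = 1 then j else k)"
  have "{a. a < n \<and> a \<in> ?I} = ?I"
    using ord by auto
  moreover have "card ?I = 3"
    using ord by simp
  ultimately have carrier: "triad A (i, j, k) \<in> carrier_mat 3 3"
    by (intro carrier_matI) (simp_all only: triad_def prod.case dim_submatrix dim)
  have below: "{a \<in> ?I. a < i} = {}" "{a \<in> ?I. a < j} = {i}" "{a \<in> ?I. a < k} = {i, j}"
    using ord by auto
  have e_simps: "e 0 = i" "e 1 = j" "e 2 = k"
    by (simp_all add: e_def)
  have rank: "card {a \<in> ?I. a < e r} = r" if "r < 3" for r
  proof -
    have "card {a \<in> ?I. a < e 0} = 0" "card {a \<in> ?I. a < e 1} = 1" "card {a \<in> ?I. a < e 2} = 2"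
      unfolding e_simps below using ord by simp_all
    moreover have "r = 0 \<or> r = 1 \<or> r = 2"
      using that by auto
    ultimately show ?thesis
      by (elim disjE) (simp_all only:)
  qed
  have e: "e r \<in> ?I" "e r < n" for r
    using ord by (auto simp: e_def)
  have entry: "triad A (i, j, k) $$ (r, s) = A $$ (e r, e s)" if "r < 3" "s < 3" for r s
  proof -
    have "submatrix A ?I ?I $$ (card {a \<in> ?I. a < e r}, card {a \<in> ?I. a < e s}) = A $$ (e r, e s)"
      by (rule submatrix_index_card) (simp_all only: e dim)
    then show ?thesis
      unfolding rank[OF that(1)] rank[OF that(2)] by (simp only: triad_def prod.case)
  qed
  show "triad A (i, j, k) \<in> pairwise_comparison_matrices 3"
    unfolding pairwise_comparison_matrices_def mem_Collect_eq
  proof (intro conjI allI impI carrier)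
    fix r s :: nat assume rs: "r < 3" "s < 3"
    show "triad A (i, j, k) $$ (r, s) > 0"
      unfolding entry[OF rs] by (rule pairwise_comparison_pos[OF A e(2) e(2)])
    show "triad A (i, j, k) $$ (r, s) = 1 / triad A (i, j, k) $$ (s, r)"
      unfolding entry[OF rs] entry[OF rs(2,1)]
      by (rule pairwise_comparison_reciprocal[OF A e(2) e(2)])
  qed
  show "triad A (i, j, k) $$ (0, 1) = A $$ (i, j)" "triad A (i, j, k) $$ (0, 2) = A $$ (i, k)"
    "triad A (i, j, k) $$ (1, 2) = A $$ (j, k)"
    by (simp_all add: entry e_def)
qed

text \<open>The case distinction in the index disappears: for \<open>n = 3\<close> the matrix is its own
  only triad, and \<open>3 choose 3 = 1\<close>.\<close>

lemma CI_eq_triad_costs: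
  assumes "n \<ge> 3" and A: "A \<in> pairwise_comparison_matrices n"
  shows "CI n A = (\<Sum>t\<in>triad_indices n. triad_cost (\<lambda>p. ln (A $$ p)) t) / real (n choose 3) - 2"
proof (cases "n = 3")
  case True
  then have "triad_indices n = {(0, 1, 2)}"
    by (auto simp: triad_indices_def)
  with True A det_pairwise_comparison_3 show ?thesis
    by (simp add: CI_def)
next
  case False
  have "det (triad A t) = triad_cost (\<lambda>p. ln (A $$ p)) t - 2" if "t \<in> triad_indices n" for t
  proof -
    obtain i j k where t: "t = (i, j, k)"
      by (cases t)
    show ?thesis
      using triad_pairwise_comparison[OF A that[unfolded t]] det_pairwise_comparison_3
      by (simp add: t triad_cost_def)
  qed
  moreover have "n choose 3 > 0"
    using \<open>n \<ge> 3\<close> by simp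
  ultimately show ?thesis
    using False by (simp add: CI_def sum_subtractf card_triad_indices diff_divide_distrib)
qed

lemma continuous_triad_costs:
  "continuous_on C (\<lambda>u. \<Sum>t\<in>triad_indices n. triad_cost u t)"
proof -
  have "continuous_on C (\<lambda>u. u p)" for p :: "nat \<times> nat" and C :: "(nat \<times> nat \<Rightarrow> real) set"
    by (rule continuous_on_subset[OF continuous_on_product_coordinates]) simp
  then show ?thesis
    unfolding triad_cost_def case_prod_unfold by (intro continuous_intros)
qed

lemma triad_costs_cong:
  assumes "\<And>i j. i < j \<Longrightarrow> j < n \<Longrightarrow> u (i, j) = v (i, j)"
  shows "(\<Sum>t\<in>triad_indices n. triad_cost u t) = (\<Sum>t\<in>triad_indices n. triad_cost v t)"
proof (rule sum.cong)
  fix t assume "t \<in> triad_indices n"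
  then obtain i j k where "t = (i, j, k)" "i < j" "j < k" "k < n"
    by (auto simp: triad_indices_def)
  then show "triad_cost u t = triad_cost v t"
    using assms[of i j] assms[of j k] assms[of i k] by (simp add: triad_cost_def)
qed simp

section \<open>Admissible logarithms\<close>

definition upper_logs :: "nat \<Rightarrow> real mat \<Rightarrow> nat \<times> nat \<Rightarrow> real" where
  "upper_logs n A p = (if p \<in> upper_pairs n then ln (A $$ p) else 0)"

text \<open>Prescribing the value 0 outside the upper triangle makes the coordinates unique and,
  above all, keeps the set of admissible functions compact.\<close>

definition admissible_logs ::
  "nat \<Rightarrow> real \<Rightarrow> real mat \<Rightarrow> nat \<Rightarrow> (nat \<times> nat \<Rightarrow> real) set" where
  "admissible_logs n M A K =
     sparse_modifications (upper_pairs n) {- ln M..ln M} (upper_logs n A) K"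

lemma ln_mem_box:
  assumes "M \<ge> 1" and "A \<in> box_matrices n M" and "i < n" "j < n"
  shows "ln (A $$ (i, j)) \<in> {- ln M..ln M}"
proof -
  have "1 / M \<le> A $$ (i, j)" "A $$ (i, j) \<le> M" "0 < 1 / M"
    using assms by (auto simp: box_matrices_def)
  moreover from this have "0 < A $$ (i, j)"
    by linarith
  ultimately have "ln (1 / M) \<le> ln (A $$ (i, j))" "ln (A $$ (i, j)) \<le> ln M"
    by (simp_all add: ln_mono)
  then show ?thesis
    using assms(1) by (simp add: ln_div)
qed

lemma is_min_value_admissible_logs:
  assumes "M \<ge> 1" and "A \<in> box_matrices n M"
  shows "\<exists>v. is_min_value (\<lambda>u. \<Sum>t\<in>triad_indices n. triad_cost u t)
    (\<lambda>u. u \<in> admissible_logs n M A K) v"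
proof (rule compact_imp_is_min_value)
  have box: "upper_logs n A p \<in> {- ln M..ln M}" if "p \<in> upper_pairs n" for p
    using that ln_mem_box[OF assms] by (cases p) (auto simp: upper_logs_def upper_pairs_def)
  then show "compact (admissible_logs n M A K)"
    unfolding admissible_logs_def
    by (intro compact_sparse_modifications finite_upper_pairs compact_Icc)
  have "upper_logs n A \<in> admissible_logs n M A K"
    using box by (simp add: admissible_logs_def sparse_modifications_def)
  then show "admissible_logs n M A K \<noteq> {}"
    by blast
qed (rule continuous_triad_costs)

section \<open>The program and the matrices in logarithmic coordinates\<close>

text \<open>The sums of the program in the form used for matrices. Antisymmetry is a rewrite rule that
  would turn \<open>x i j\<close> into the lower-triangular \<open>- x j i\<close>, so the constraints are
  taken apart without simplification.\<close>

lemma feasible_iff_triad_costs: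
  "feasible n M A K \<alpha> x y \<longleftrightarrow>
     (\<Sum>t\<in>triad_indices n. triad_cost (\<lambda>(i, j). x i j) t) \<le> \<alpha> \<and>
     (\<forall>i j. i < j \<and> j < n \<longrightarrow>
        x i j = - x j i \<and>
        - ln M \<le> x i j \<and> x i j \<le> ln M \<and>
        - 2 * ln M * y i j \<le> x i j - ln (A $$ (i, j)) \<and>
        x i j - ln (A $$ (i, j)) \<le> 2 * ln M * y i j \<and>
        y i j \<in> {0, 1}) \<and>
     (\<Sum>(i, j)\<in>upper_pairs n. y i j) \<le> real K"
  unfolding feasible_def sum_upper_pairs sum_triad_indices triad_cost_def prod.case by (rule refl)

text \<open>Where \<open>y i j = 0\<close> the big-M constraint forces the old logarithm, so every modified place
  costs one unit of the budget. There may be fewer modifications than units spent, because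
  \<open>y i j = 1\<close> permits a change without requiring it.\<close>

lemma feasible_imp_admissible_logs:
  assumes feas: "feasible n M A K \<alpha> x y"
  shows "\<exists>u\<in>admissible_logs n M A K. (\<Sum>t\<in>triad_indices n. triad_cost u t) \<le> \<alpha>"
proof
  define u where "u = (\<lambda>(i, j). if (i, j) \<in> upper_pairs n then x i j else 0)"
  have pair: "- ln M \<le> x i j" "x i j \<le> ln M" "y i j \<in> {0, 1}"
    "y i j = 0 \<Longrightarrow> x i j = ln (A $$ (i, j))" if "(i, j) \<in> upper_pairs n" for i j
  proof -
    have "i < j \<and> j < n"
      using that by (simp add: upper_pairs_def)
    with feas show "- ln M \<le> x i j" "x i j \<le> ln M" "y i j \<in> {0, 1}"
      unfolding feasible_iff_triad_costs by blast+
    have "- 2 * ln M * y i j \<le> x i j - ln (A $$ (i, j))"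
      "x i j - ln (A $$ (i, j)) \<le> 2 * ln M * y i j"
      using feas \<open>i < j \<and> j < n\<close> unfolding feasible_iff_triad_costs by blast+
    then show "x i j = ln (A $$ (i, j))" if "y i j = 0"
      using that by simp
  qed
  have "real (card {p \<in> upper_pairs n. u p \<noteq> upper_logs n A p})
      = (\<Sum>p\<in>upper_pairs n. if u p \<noteq> upper_logs n A p then 1 else 0)"
    by (simp add: finite_upper_pairs sum.If_cases Int_def)
  also have "\<dots> \<le> (\<Sum>(i, j)\<in>upper_pairs n. y i j)"
  proof (rule sum_mono, clarify)
    fix i j assume "(i, j) \<in> upper_pairs n"
    then show "(if u (i, j) \<noteq> upper_logs n A (i, j) then 1 else 0) \<le> y i j"
      using pair[of i j] by (auto simp: u_def upper_logs_def)
  qed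
  also have "\<dots> \<le> real K"
    using feas unfolding feasible_iff_triad_costs by blast
  finally have "card {p \<in> upper_pairs n. u p \<noteq> upper_logs n A p} \<le> K"
    by simp
  then show "u \<in> admissible_logs n M A K"
    using pair by (auto simp: admissible_logs_def sparse_modifications_def u_def upper_logs_def)
  have "(\<Sum>t\<in>triad_indices n. triad_cost u t) =
      (\<Sum>t\<in>triad_indices n. triad_cost (\<lambda>(i, j). x i j) t)"
    by (rule triad_costs_cong) (simp add: u_def upper_pairs_def)
  also have "\<dots> \<le> \<alpha>"
    using feas unfolding feasible_iff_triad_costs by blast
  finally show "(\<Sum>t\<in>triad_indices n. triad_cost u t) \<le> \<alpha>" .
qed

text \<open>The witness for \<open>y\<close> is the indicator of the modified places. There the big-M constraint
  holds because both logarithms lie in an interval of length \<open>2 * ln M\<close>.\<close>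

lemma admissible_logs_imp_feasible:
  assumes "M \<ge> 1" and A: "A \<in> box_matrices n M" and u: "u \<in> admissible_logs n M A K"
  shows "\<exists>x y. feasible n M A K (\<Sum>t\<in>triad_indices n. triad_cost u t) x y"
proof (intro exI)
  define x where "x = (\<lambda>i j. if i < j then u (i, j) else - u (j, i))"
  define y :: "nat \<Rightarrow> nat \<Rightarrow> real"
    where "y = (\<lambda>i j. if u (i, j) \<noteq> upper_logs n A (i, j) then 1 else 0)"
  have "(\<Sum>t\<in>triad_indices n. triad_cost (\<lambda>(i, j). x i j) t)
      = (\<Sum>t\<in>triad_indices n. triad_cost u t)"
    by (rule triad_costs_cong) (simp add: x_def)
  then have "(\<Sum>t\<in>triad_indices n. triad_cost (\<lambda>(i, j). x i j) t)
      \<le> (\<Sum>t\<in>triad_indices n. triad_cost u t)"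
    by (rule eq_refl)
  moreover have "x i j = - x j i \<and> - ln M \<le> x i j \<and> x i j \<le> ln M \<and>
      - 2 * ln M * y i j \<le> x i j - ln (A $$ (i, j)) \<and>
      x i j - ln (A $$ (i, j)) \<le> 2 * ln M * y i j \<and> y i j \<in> {0, 1}"
    if "i < j" "j < n" for i j
  proof -
    have "(i, j) \<in> upper_pairs n"
      using that by (simp add: upper_pairs_def)
    moreover from this have "u (i, j) \<in> {- ln M..ln M}"
      using u by (simp add: admissible_logs_def sparse_modifications_def)
    moreover have "ln (A $$ (i, j)) \<in> {- ln M..ln M}"
      using ln_mem_box[OF assms(1) A] that by simp
    ultimately show ?thesis
      using \<open>i < j\<close> by (auto simp: x_def y_def upper_logs_def)
  qed
  moreover have "(\<Sum>(i, j)\<in>upper_pairs n. y i j)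
      = real (card {p \<in> upper_pairs n. u p \<noteq> upper_logs n A p})"
    by (simp add: y_def case_prod_unfold finite_upper_pairs sum.If_cases Int_def)
  then have "(\<Sum>(i, j)\<in>upper_pairs n. y i j) \<le> real K"
    using u by (simp add: admissible_logs_def sparse_modifications_def)
  ultimately show "feasible n M A K (\<Sum>t\<in>triad_indices n. triad_cost u t) x y"
    unfolding feasible_iff_triad_costs by blast
qed

text \<open>The entries are positive and the logarithm is injective there, so it changes exactly
  where the entry does.\<close>

lemma upper_diff_eq_card_logs:
  assumes "A \<in> pairwise_comparison_matrices n" and "B \<in> pairwise_comparison_matrices n"
  shows "upper_diff n A B = card {p \<in> upper_pairs n. upper_logs n B p \<noteq> upper_logs n A p}"
proof -
  have "A $$ (i, j) = B $$ (i, j) \<longleftrightarrow> upper_logs n B (i, j) = upper_logs n A (i, j)"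
    if "i < j" "j < n" for i j
    using that pairwise_comparison_pos[OF assms(1), of i j] pairwise_comparison_pos[OF assms(2), of i j]
    by (auto simp: upper_logs_def upper_pairs_def)
  then have "{(i, j). i < j \<and> j < n \<and> A $$ (i, j) \<noteq> B $$ (i, j)}
      = {p \<in> upper_pairs n. upper_logs n B p \<noteq> upper_logs n A p}"
    by (auto simp: upper_pairs_def)
  then show ?thesis
    by (simp add: upper_diff_def)
qed

lemma upper_logs_admissible:
  assumes "M \<ge> 1" and "A \<in> pairwise_comparison_matrices n"
    and "B \<in> pairwise_comparison_matrices n" and "B \<in> box_matrices n M" and "upper_diff n A B \<le> K"
  shows "upper_logs n B \<in> admissible_logs n M A K"
  using assms(5) ln_mem_box[OF assms(1,4)] upper_diff_eq_card_logs[OF assms(2,3)]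
  by (auto simp: admissible_logs_def sparse_modifications_def upper_logs_def upper_pairs_def)

lemma CI_eq_upper_logs:
  assumes "n \<ge> 3" and "B \<in> pairwise_comparison_matrices n"
  shows "CI n B = (\<Sum>t\<in>triad_indices n. triad_cost (upper_logs n B) t) / real (n choose 3) - 2"
proof -
  have "(\<Sum>t\<in>triad_indices n. triad_cost (\<lambda>p. ln (B $$ p)) t)
      = (\<Sum>t\<in>triad_indices n. triad_cost (upper_logs n B) t)"
    by (rule triad_costs_cong) (simp add: upper_logs_def upper_pairs_def)
  then show ?thesis
    by (simp add: CI_eq_triad_costs[OF assms])
qed

lemma admissible_logs_realized:
  assumes "M \<ge> 1" and A: "A \<in> pairwise_comparison_matrices n" and u: "u \<in> admissible_logs n M A K"
  shows "\<exists>B. B \<in> pairwise_comparison_matrices n \<inter> box_matrices n M \<and> upper_diff n A B \<le> K \<and>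
    upper_logs n B = u"
proof -
  \<comment> \<open>The antisymmetric extension of \<open>u\<close> becomes reciprocity after exponentiation; the zero
    diagonal becomes the diagonal of ones.\<close>
  define x where "x = (\<lambda>i j. if i < j then u (i, j) else if j < i then - u (j, i) else 0)"
  define B where "B = mat n n (\<lambda>(i, j). exp (x i j))"
  have entry: "B $$ (i, j) = exp (x i j)" if "i < n" "j < n" for i j
    using that by (simp add: B_def)
  have reciprocal: "exp (x i j) = 1 / exp (x j i)" for i j
  proof -
    have "x i j = - x j i"
      by (simp add: x_def)
    then show ?thesis
      by (simp only: exp_minus inverse_eq_divide)
  qed
  have B: "B \<in> pairwise_comparison_matrices n"
    unfolding pairwise_comparison_matrices_def mem_Collect_eq
  proof (intro conjI allI impI)
    show "B \<in> carrier_mat n n"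
      by (simp add: B_def)
    fix i j assume ij: "i < n" "j < n"
    show "B $$ (i, j) > 0"
      by (simp add: entry[OF ij])
    show "B $$ (i, j) = 1 / B $$ (j, i)"
      unfolding entry[OF ij] entry[OF ij(2,1)] by (rule reciprocal)
  qed
  have box: "- ln M \<le> x i j" "x i j \<le> ln M" if "i < n" "j < n" for i j
  proof -
    have "u (i', j') \<in> {- ln M..ln M}" if "i' < j'" "j' < n" for i' j'
      using u that by (simp add: admissible_logs_def sparse_modifications_def upper_pairs_def)
    then show "- ln M \<le> x i j" "x i j \<le> ln M"
      using that \<open>M \<ge> 1\<close> by (fastforce simp: x_def)+
  qed
  have "exp (- ln M) \<le> exp (x i j)" "exp (x i j) \<le> exp (ln M)" if "i < n" "j < n" for i j
    using box[OF that] by (simp_all only: exp_le_cancel_iff)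
  then have "B \<in> box_matrices n M"
    using \<open>M \<ge> 1\<close> by (simp add: box_matrices_def B_def exp_minus inverse_eq_divide)
  moreover have logs: "upper_logs n B = u"
  proof
    fix p show "upper_logs n B p = u p"
      using u by (cases p) (auto simp: upper_logs_def B_def x_def upper_pairs_def
        admissible_logs_def sparse_modifications_def)
  qed
  moreover have "upper_diff n A B \<le> K"
    using u by (simp add: upper_diff_eq_card_logs[OF A B] logs admissible_logs_def
      sparse_modifications_def)
  ultimately show ?thesis
    using B by blast
qed

theorem theorem9:
  fixes n K :: nat and M :: real and A :: "real mat"
  assumes "n \<ge> 3" and "M \<ge> 1"
    and "A \<in> pairwise_comparison_matrices n \<inter> box_matrices n M"
  shows "\<exists>\<alpha>_opt.
      is_min_value (\<lambda>(\<alpha>, x, y). \<alpha>) (\<lambda>(\<alpha>, x, y). feasible n M A K \<alpha> x y) \<alpha>_opt \<and>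
      is_min_value (CI n)
        (\<lambda>B. B \<in> pairwise_comparison_matrices n \<inter> box_matrices n M \<and> upper_diff n A B \<le> K)
        (\<alpha>_opt / real (n choose 3) - 2)"
proof -
  have A: "A \<in> pairwise_comparison_matrices n" "A \<in> box_matrices n M"
    using assms(3) by auto
  let ?S = "\<lambda>u. \<Sum>t\<in>triad_indices n. triad_cost u t"
  let ?C = "admissible_logs n M A K"
  let ?h = "\<lambda>s. s / real (n choose 3) - 2"
  obtain v where v: "is_min_value ?S (\<lambda>u. u \<in> ?C) v"
    using is_min_value_admissible_logs[OF assms(2) A(2)] by blast
  have "is_min_value (\<lambda>(\<alpha>, x, y). \<alpha>) (\<lambda>(\<alpha>, x, y). feasible n M A K \<alpha> x y) v"
  proof (rule is_min_value_transfer[OF v])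
    fix z :: "real \<times> (nat \<Rightarrow> nat \<Rightarrow> real) \<times> (nat \<Rightarrow> nat \<Rightarrow> real)"
    assume "case z of (\<alpha>, x, y) \<Rightarrow> feasible n M A K \<alpha> x y"
    then show "\<exists>u. u \<in> ?C \<and> ?S u \<le> (case z of (\<alpha>, x, y) \<Rightarrow> \<alpha>)"
      using feasible_imp_admissible_logs by (fastforce split: prod.splits)
  next
    fix u assume "u \<in> ?C"
    then obtain x y where "feasible n M A K (?S u) x y"
      using admissible_logs_imp_feasible[OF assms(2) A(2)] by blast
    then show "\<exists>z. (case z of (\<alpha>, x, y) \<Rightarrow> feasible n M A K \<alpha> x y) \<and>
        (case z of (\<alpha>, x, y) \<Rightarrow> \<alpha>) \<le> ?S u"
      by (intro exI[of _ "(?S u, x, y)"]) simp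
  qed
  moreover have "mono ?h"
    by (intro monoI diff_right_mono divide_right_mono) auto
  then have "is_min_value (\<lambda>u. ?h (?S u)) (\<lambda>u. u \<in> ?C) (?h v)"
    by (rule is_min_value_mono[OF v])
  then have "is_min_value (CI n)
      (\<lambda>B. B \<in> pairwise_comparison_matrices n \<inter> box_matrices n M \<and> upper_diff n A B \<le> K) (?h v)"
  proof (rule is_min_value_transfer)
    fix B
    assume "B \<in> pairwise_comparison_matrices n \<inter> box_matrices n M \<and> upper_diff n A B \<le> K"
    then show "\<exists>u. u \<in> ?C \<and> ?h (?S u) \<le> CI n B"
      using upper_logs_admissible[OF assms(2) A(1)] CI_eq_upper_logs[OF assms(1)]
      by (intro exI[of _ "upper_logs n B"]) auto
  next
    fix u assume "u \<in> ?C"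
    from admissible_logs_realized[OF assms(2) A(1) this]
    show "\<exists>B. (B \<in> pairwise_comparison_matrices n \<inter> box_matrices n M \<and> upper_diff n A B \<le> K) \<and>
        CI n B \<le> ?h (?S u)"
      using CI_eq_upper_logs[OF assms(1)] by fastforce
  qed
  ultimately show ?thesis
    by blast
qed

end
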